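(* Let $a>0$ and $K=[-a,a]$. All functions below are assumed nonzero. (i) Let $\lambda,\gamma\in\mathbb R\setminus\{0\}$ and $\tau\in\mathbb R$. For every $f\in\mathcal F_{supp}(K)$ the function $g_{\lambda,\gamma,\tau}(x):=\lambda f(\gamma x-\tau)$ satisfies $U(g_{\lambda,\gamma,\tau})=U(f)$. (ii) The following inequalities hold: $$\inf_{\substack{f\in\mathcal F_{supp}(K)\\ \|f\|\le1}}U[f]\le\inf_{\substack{f\in\mathcal F_{supp}(K)\\ \|f\|=1}}U[f],\qquad \inf_{\substack{f\in\mathcal F_{supp}(K)\\ \|f\|\ge1}}U[f]\le\inf_{\substack{f\in\mathcal F_{supp}(K)\\ \|f\|=1}}U[f].$$ (iii) $U[\lambda f]=U[f]$ for all $\lambda\in\mathbb R\setminus\{0\}$ and all $f\in\mathcal F_{supp}(K)$.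
   Context: For $K=[-a,a]$, $\mathcal F_{supp}(K)$ is the set of real functions $f=\sum_{i=1}^n P_i\,\mathbf 1_{[a_i,b_i)}$, for some $n\in\mathbb N$, with real polynomials $P_i$ and $-a=a_1<b_1=a_2<\dots<b_{n-1}=a_n<b_n=a$, such that $\lim_{x\to a_i^-}f(x)=f(a_i)$ for $i=2,\dots,n$, and with $f(a)$ equal to the (finite) limit $\lim_{x\to a^-}f(x)$; thus $f$ is a continuous piecewise polynomial on $K$, extended by $0$ outside $K$ (it need not vanish at $\pm a$). For a nonzero compactly supported $f\in L^2(\mathbb R)$, with $\|\cdot\|$ the $L^2$ norm and $\hat f(\omega)=\int_{\mathbb R}e^{-i\omega x}f(x)\,dx$, set $\alpha[f]=\frac1{\|f\|^2}\int x|f(x)|^2dx$, $\sigma_x^2[f]=\frac1{\|f\|^2}\int (x-\alpha[f])^2|f(x)|^2dx$, $\beta[\hat f]=\frac1{2\pi\|f\|^2}\int_{\mathbb R}\omega|\hat f(\omega)|^2d\omega$, $\sigma_\omega^2[\hat f]=\frac1{2\pi\|f\|^2}\int_{\mathbb R}(\omega-\beta[\hat f])^2|\hat f(\omega)|^2d\omega$, with $\sigma_\omega^2[\hat f]=+\infty$ whenever $\int\omega^2|\hat f(\omega)|^2d\omega=+\infty$, and $U[f]=\sigma_x^2[f]\,\sigma_\omega^2[\hat f]\in[0,+\infty]$. *)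

theory Defs
  imports "HOL-Analysis.Analysis" "HOL-Computational_Algebra.Polynomial"
begin

text \<open>
  Piecewise polynomials on \<open>[-a, a]\<close>, extended by \<open>0\<close>, with pieces \<open>[l i, r i)\<close> for \<open>i = 1, \<dots>, n\<close>.
  The sum of half-open pieces vanishes at the right endpoint \<open>a\<close>; the value there is instead the
  left limit.
\<close>

definition F_supp :: "real \<Rightarrow> (real \<Rightarrow> real) set" where
  "F_supp a = {f. \<exists>(n::nat) (l::nat \<Rightarrow> real) (r::nat \<Rightarrow> real) (P::nat \<Rightarrow> real poly).
      n \<ge> 1 \<and> l 1 = - a \<and> r n = a \<and>
      (\<forall>i\<in>{1..n}. l i < r i) \<and> (\<forall>i\<in>{1..<n}. r i = l (i + 1)) \<and>
      (\<forall>x. x \<noteq> a \<longrightarrow> f x = (\<Sum>i=1..n. poly (P i) x * indicator {l i..<r i} x)) \<and>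
      (\<forall>i\<in>{2..n}. (f \<longlongrightarrow> f (l i)) (at_left (l i))) \<and>
      (f \<longlongrightarrow> f a) (at_left a)}"

definition L2_norm :: "(real \<Rightarrow> complex) \<Rightarrow> real" where
  "L2_norm f = sqrt (LINT x|lborel. (cmod (f x))\<^sup>2)"

definition fourier :: "(real \<Rightarrow> complex) \<Rightarrow> real \<Rightarrow> complex" where
  "fourier f \<omega> = (LINT x|lborel. exp (- (\<i> * complex_of_real (\<omega> * x))) * f x)"

definition alpha :: "(real \<Rightarrow> complex) \<Rightarrow> real" where
  "alpha f = 1 / (L2_norm f)\<^sup>2 * (LINT x|lborel. x * (cmod (f x))\<^sup>2)"

definition var_x :: "(real \<Rightarrow> complex) \<Rightarrow> real" where
  "var_x f = 1 / (L2_norm f)\<^sup>2 * (LINT x|lborel. (x - alpha f)\<^sup>2 * (cmod (f x))\<^sup>2)"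

text \<open>
  The next two definitions take \<open>f\<close> rather than its transform as argument.  If
  \<open>\<omega> * (cmod (fourier f \<omega>))\<^sup>2\<close> is not integrable, \<open>beta f\<close> is a junk value; for compactly supported \<open>f\<close> in \<open>L\<^sup>2\<close> the second
  moment is then infinite, so \<open>var_omega f\<close> does not depend on it.
\<close>

definition beta :: "(real \<Rightarrow> complex) \<Rightarrow> real" where
  "beta f = 1 / (2 * pi * (L2_norm f)\<^sup>2) * (LINT \<omega>|lborel. \<omega> * (cmod (fourier f \<omega>))\<^sup>2)"

definition var_omega :: "(real \<Rightarrow> complex) \<Rightarrow> ennreal" where
  "var_omega f =
     (if (\<integral>\<^sup>+\<omega>. ennreal (\<omega>\<^sup>2 * (cmod (fourier f \<omega>))\<^sup>2) \<partial>lborel) = \<infinity> then \<infinity>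
      else ennreal (1 / (2 * pi * (L2_norm f)\<^sup>2) *
             (LINT \<omega>|lborel. (\<omega> - beta f)\<^sup>2 * (cmod (fourier f \<omega>))\<^sup>2)))"

text \<open>
  In \<open>ennreal\<close>, \<open>0 * \<infinity> = 0\<close>; this product does not occur for nonzero \<open>f\<close>, where \<open>var_x f > 0\<close>.
\<close>

definition U :: "(real \<Rightarrow> complex) \<Rightarrow> ennreal" where
  "U f = ennreal (var_x f) * var_omega f"

end

theory Submission
  imports Defs
begin

text \<open>
  Scaling, dilation and translation act on all four moments by explicit factors.  For
  \<open>g x = c * f (\<gamma> * x - \<tau>)\<close> the substitution \<open>y = \<gamma> * x - \<tau>\<close> turns the mean into
  \<open>(\<alpha> + \<tau>) / \<gamma>\<close> and divides the spatial variance by \<open>\<gamma>\<^sup>2\<close>, while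
  \<open>\<bar>fourier g \<omega>\<bar> = \<bar>c / \<gamma>\<bar> * \<bar>fourier f (\<omega> / \<gamma>)\<bar>\<close> multiplies the frequency mean by \<open>\<gamma>\<close> and the
  frequency variance by \<open>\<gamma>\<^sup>2\<close> (also when it is infinite); the factors cancel in the product \<open>U\<close>.
  This works whenever \<open>f\<close> has nonzero norm; if the norm is zero, \<open>U\<close> vanishes on both sides.  The
  equality of \<open>U\<close> thus holds for every measurable \<open>f\<close> for which \<open>\<bar>f\<bar>\<^sup>2\<close> and \<open>x * \<bar>f\<bar>\<^sup>2\<close> are integrable
  (\<open>U_affine\<close>), and piecewise polynomials are such functions.  The comparisons of infima
  only use that the unit sphere lies in the unit ball and in the complement of the open unit ball.
\<close>

section \<open>The moments under affine substitutions\<close>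

lemma lebesgue_integral_affine:
  fixes h :: "real \<Rightarrow> 'b::{banach, second_countable_topology}"
  assumes "\<gamma> \<noteq> 0"
  shows "(LINT x|lborel. h (\<gamma> * x - \<tau>)) = (1 / \<bar>\<gamma>\<bar>) *\<^sub>R (LINT y|lborel. h y)"
  using assms lborel_integral_real_affine[of \<gamma> h "- \<tau>"] by simp

lemma L2_norm_sq: "(L2_norm f)\<^sup>2 = (LINT x|lborel. (cmod (f x))\<^sup>2)"
  unfolding L2_norm_def by (simp add: integral_nonneg_AE)

lemma L2_norm_sq_affine:
  assumes "\<gamma> \<noteq> 0"
  shows "(L2_norm (\<lambda>x. c * f (\<gamma> * x - \<tau>)))\<^sup>2 = (cmod c)\<^sup>2 / \<bar>\<gamma>\<bar> * (L2_norm f)\<^sup>2"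
  using lebesgue_integral_affine[OF assms, of "\<lambda>x. (cmod c)\<^sup>2 * (cmod (f x))\<^sup>2" \<tau>]
  by (simp add: L2_norm_sq norm_mult power_mult_distrib)

lemma alpha_affine:
  assumes "c \<noteq> 0" "\<gamma> \<noteq> 0" "L2_norm f \<noteq> 0"
    and int: "integrable lborel (\<lambda>x. (cmod (f x))\<^sup>2)" "integrable lborel (\<lambda>x. x * (cmod (f x))\<^sup>2)"
  shows "alpha (\<lambda>x. c * f (\<gamma> * x - \<tau>)) = (alpha f + \<tau>) / \<gamma>"
proof -
  let ?h = "\<lambda>y. (y + \<tau>) / \<gamma> * ((cmod c)\<^sup>2 * (cmod (f y))\<^sup>2)"
  let ?M = "LINT y|lborel. y * (cmod (f y))\<^sup>2"
  have "(LINT x|lborel. x * (cmod (c * f (\<gamma> * x - \<tau>)))\<^sup>2) = (LINT x|lborel. ?h (\<gamma> * x - \<tau>))"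
    using assms(2) by (simp add: norm_mult power_mult_distrib)
  also have "\<dots> = 1 / \<bar>\<gamma>\<bar> * (LINT y|lborel. ?h y)"
    using lebesgue_integral_affine[OF assms(2), of ?h \<tau>] by simp
  also have "(LINT y|lborel. ?h y) =
      (LINT y|lborel. (cmod c)\<^sup>2 / \<gamma> * (y * (cmod (f y))\<^sup>2 + \<tau> * (cmod (f y))\<^sup>2))"
    by (intro Bochner_Integration.integral_cong) (auto simp: field_simps)
  also have "\<dots> = (cmod c)\<^sup>2 / \<gamma> * (?M + \<tau> * (L2_norm f)\<^sup>2)"
    using int by (simp add: L2_norm_sq)
  finally show ?thesis
    using assms(1-3) unfolding alpha_def L2_norm_sq_affine[OF assms(2)]
    by (simp add: field_simps)
qed

lemma var_x_affine:
  assumes "c \<noteq> 0" "\<gamma> \<noteq> 0" "L2_norm f \<noteq> 0"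
    and "integrable lborel (\<lambda>x. (cmod (f x))\<^sup>2)" "integrable lborel (\<lambda>x. x * (cmod (f x))\<^sup>2)"
  shows "var_x (\<lambda>x. c * f (\<gamma> * x - \<tau>)) = var_x f / \<gamma>\<^sup>2"
proof -
  let ?h = "\<lambda>y. (cmod c)\<^sup>2 / \<gamma>\<^sup>2 * ((y - alpha f)\<^sup>2 * (cmod (f y))\<^sup>2)"
  have "x - (alpha f + \<tau>) / \<gamma> = (\<gamma> * x - \<tau> - alpha f) / \<gamma>" for x
    using assms(2) by (simp add: field_simps)
  then have "(LINT x|lborel. (x - (alpha f + \<tau>) / \<gamma>)\<^sup>2 * (cmod (c * f (\<gamma> * x - \<tau>)))\<^sup>2)
      = (LINT x|lborel. ?h (\<gamma> * x - \<tau>))"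
    by (simp add: norm_mult power_mult_distrib power_divide mult_ac)
  also have "\<dots> = 1 / \<bar>\<gamma>\<bar> * ((cmod c)\<^sup>2 / \<gamma>\<^sup>2 * (LINT y|lborel. (y - alpha f)\<^sup>2 * (cmod (f y))\<^sup>2))"
    using lebesgue_integral_affine[OF assms(2), of ?h \<tau>] by simp
  finally show ?thesis
    using assms(1-3) unfolding var_x_def alpha_affine[OF assms] L2_norm_sq_affine[OF assms(2)]
    by (simp add: field_simps)
qed

lemma fourier_affine:
  assumes "\<gamma> \<noteq> 0"
  shows "fourier (\<lambda>x. c * f (\<gamma> * x - \<tau>)) \<omega> =
    c / \<bar>\<gamma>\<bar> * exp (- (\<i> * complex_of_real (\<omega> * \<tau> / \<gamma>))) * fourier f (\<omega> / \<gamma>)"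
proof -
  let ?e = "\<lambda>t. exp (- (\<i> * complex_of_real t))"
  have e: "?e (s + t) = ?e s * ?e t" for s t
    by (simp add: exp_add [symmetric] algebra_simps)
  let ?h = "\<lambda>y. c * ?e (\<omega> * \<tau> / \<gamma>) * (?e (\<omega> / \<gamma> * y) * f y)"
  have "\<omega> * x = \<omega> * \<tau> / \<gamma> + \<omega> / \<gamma> * (\<gamma> * x - \<tau>)" for x
    using assms by (simp add: field_simps)
  then have split: "?e (\<omega> * x) = ?e (\<omega> * \<tau> / \<gamma>) * ?e (\<omega> / \<gamma> * (\<gamma> * x - \<tau>))" for x
    using e by metis
  have "?e (\<omega> * x) * (c * f (\<gamma> * x - \<tau>)) = ?h (\<gamma> * x - \<tau>)" for x
    unfolding split by (simp only: mult_ac)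
  then have "fourier (\<lambda>x. c * f (\<gamma> * x - \<tau>)) \<omega> = (LINT x|lborel. ?h (\<gamma> * x - \<tau>))"
    unfolding fourier_def by presburger
  also have "\<dots> = (1 / \<bar>\<gamma>\<bar>) *\<^sub>R (LINT y|lborel. ?h y)"
    by (rule lebesgue_integral_affine[OF assms])
  also have "(LINT y|lborel. ?h y) = c * ?e (\<omega> * \<tau> / \<gamma>) * fourier f (\<omega> / \<gamma>)"
    unfolding fourier_def by (rule integral_mult_right_zero)
  finally show ?thesis
    by (simp add: scaleR_conv_of_real)
qed

lemma cmod_fourier_affine:
  assumes "\<gamma> \<noteq> 0"
  shows "(cmod (fourier (\<lambda>x. c * f (\<gamma> * x - \<tau>)) \<omega>))\<^sup>2 =
    (cmod c)\<^sup>2 / \<gamma>\<^sup>2 * (cmod (fourier f (\<omega> / \<gamma>)))\<^sup>2"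
  unfolding fourier_affine[OF assms]
  by (simp add: norm_mult norm_divide power_mult_distrib power_divide)

lemma borel_measurable_fourier:
  assumes [measurable]: "f \<in> borel_measurable borel"
  shows "fourier f \<in> borel_measurable borel"
  unfolding fourier_def by measurable

text \<open>
  No integrability is needed here: no sum is split, and the substitution rule and the extraction of
  constant factors remain true when the integral has its default value \<open>0\<close>.
\<close>

lemma beta_affine:
  assumes "c \<noteq> 0" "\<gamma> \<noteq> 0" "L2_norm f \<noteq> 0"
  shows "beta (\<lambda>x. c * f (\<gamma> * x - \<tau>)) = \<gamma> * beta f"
proof -
  let ?M = "LINT w|lborel. w * (cmod (fourier f w))\<^sup>2"
  let ?h = "\<lambda>w. (cmod c)\<^sup>2 / \<gamma> * (w * (cmod (fourier f w))\<^sup>2)"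
  have "(LINT \<omega>|lborel. \<omega> * (cmod (fourier (\<lambda>x. c * f (\<gamma> * x - \<tau>)) \<omega>))\<^sup>2)
      = (LINT \<omega>|lborel. ?h (1 / \<gamma> * \<omega> - 0))"
    unfolding cmod_fourier_affine[OF assms(2)]
    by (intro Bochner_Integration.integral_cong) (auto simp: power2_eq_square)
  also have "\<dots> = \<bar>\<gamma>\<bar> * ((cmod c)\<^sup>2 / \<gamma> * ?M)"
    using lebesgue_integral_affine[of "1 / \<gamma>" ?h 0] assms(2) by simp
  finally show ?thesis
    using assms unfolding beta_def L2_norm_sq_affine[OF assms(2)]
    by (simp add: field_simps abs_mult_self_eq)
qed

lemma var_omega_affine:
  assumes "c \<noteq> 0" "\<gamma> \<noteq> 0" "L2_norm f \<noteq> 0" and f: "f \<in> borel_measurable borel"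
  shows "var_omega (\<lambda>x. c * f (\<gamma> * x - \<tau>)) = ennreal (\<gamma>\<^sup>2) * var_omega f"
proof -
  note [measurable] = borel_measurable_fourier[OF f]
  let ?g = "\<lambda>x. c * f (\<gamma> * x - \<tau>)"
  let ?n = "\<lambda>w. ennreal (w\<^sup>2 * (cmod (fourier f w))\<^sup>2)"
  have "(\<integral>\<^sup>+w. ?n w \<partial>lborel) = ennreal \<bar>1 / \<gamma>\<bar> * (\<integral>\<^sup>+\<omega>. ?n (0 + 1 / \<gamma> * \<omega>) \<partial>lborel)"
    using assms(2) by (intro nn_integral_real_affine) auto
  also have "(\<integral>\<^sup>+\<omega>. ?n (0 + 1 / \<gamma> * \<omega>) \<partial>lborel)
      = (\<integral>\<^sup>+\<omega>. ennreal (1 / (cmod c)\<^sup>2) * ennreal (\<omega>\<^sup>2 * (cmod (fourier ?g \<omega>))\<^sup>2) \<partial>lborel)"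
    using assms(1,2)
    by (intro nn_integral_cong, subst ennreal_mult [symmetric])
       (auto simp: cmod_fourier_affine power_divide)
  also have "\<dots> = ennreal (1 / (cmod c)\<^sup>2) * (\<integral>\<^sup>+\<omega>. ennreal (\<omega>\<^sup>2 * (cmod (fourier ?g \<omega>))\<^sup>2) \<partial>lborel)"
    using assms(2) by (intro nn_integral_cmult) (simp add: cmod_fourier_affine)
  finally have inf_iff: "(\<integral>\<^sup>+w. ?n w \<partial>lborel) = \<infinity> \<longleftrightarrow>
      (\<integral>\<^sup>+\<omega>. ennreal (\<omega>\<^sup>2 * (cmod (fourier ?g \<omega>))\<^sup>2) \<partial>lborel) = \<infinity>"
    using assms(1,2) by (simp add: ennreal_mult_eq_top_iff)
  let ?M = "LINT w|lborel. (w - beta f)\<^sup>2 * (cmod (fourier f w))\<^sup>2"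
  let ?h = "\<lambda>w. (cmod c)\<^sup>2 * ((w - beta f)\<^sup>2 * (cmod (fourier f w))\<^sup>2)"
  have shift: "\<omega> - \<gamma> * beta f = \<gamma> * (\<omega> / \<gamma> - beta f)" for \<omega>
    using assms(2) by (simp add: field_simps)
  have "(LINT \<omega>|lborel. (\<omega> - beta ?g)\<^sup>2 * (cmod (fourier ?g \<omega>))\<^sup>2)
      = (LINT \<omega>|lborel. ?h (1 / \<gamma> * \<omega> - 0))"
    unfolding beta_affine[OF assms(1-3)] cmod_fourier_affine[OF assms(2)] shift power_mult_distrib
    using assms(2) by (intro Bochner_Integration.integral_cong) auto
  also have "\<dots> = \<bar>\<gamma>\<bar> * ((cmod c)\<^sup>2 * ?M)"
    using lebesgue_integral_affine[of "1 / \<gamma>" ?h 0] assms(2) by simp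
  finally have "1 / (2 * pi * (L2_norm ?g)\<^sup>2) *
        (LINT \<omega>|lborel. (\<omega> - beta ?g)\<^sup>2 * (cmod (fourier ?g \<omega>))\<^sup>2)
      = \<gamma>\<^sup>2 * (1 / (2 * pi * (L2_norm f)\<^sup>2) * ?M)"
    using assms(1-3) unfolding L2_norm_sq_affine[OF assms(2)]
    by (simp add: field_simps power2_eq_square)
  then have "ennreal (1 / (2 * pi * (L2_norm ?g)\<^sup>2) *
        (LINT \<omega>|lborel. (\<omega> - beta ?g)\<^sup>2 * (cmod (fourier ?g \<omega>))\<^sup>2))
      = ennreal (\<gamma>\<^sup>2) * ennreal (1 / (2 * pi * (L2_norm f)\<^sup>2) * ?M)"
    by (simp only: ennreal_mult' zero_le_power2)
  moreover have "ennreal (\<gamma>\<^sup>2) * \<infinity> = \<infinity>"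
    using assms(2) by (simp add: ennreal_mult_top)
  ultimately show ?thesis
    unfolding var_omega_def inf_iff by (simp only: if_distrib split: if_split) simp
qed

lemma U_affine:
  assumes "c \<noteq> 0" "\<gamma> \<noteq> 0" "f \<in> borel_measurable borel"
    "integrable lborel (\<lambda>x. (cmod (f x))\<^sup>2)" "integrable lborel (\<lambda>x. x * (cmod (f x))\<^sup>2)"
  shows "U (\<lambda>x. c * f (\<gamma> * x - \<tau>)) = U f"
proof (cases "L2_norm f = 0")
  case True
  \<comment> \<open>Both norms vanish, and division by zero makes both spatial variances \<open>0\<close>.\<close>
  then have "(L2_norm (\<lambda>x. c * f (\<gamma> * x - \<tau>)))\<^sup>2 = 0"
    by (simp add: L2_norm_sq_affine[OF assms(2)])
  with True show ?thesis
    by (simp add: U_def var_x_def)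
next
  case False
  have "var_x f / \<gamma>\<^sup>2 * \<gamma>\<^sup>2 = var_x f"
    using assms(2) by simp
  then have "ennreal (var_x f / \<gamma>\<^sup>2) * ennreal (\<gamma>\<^sup>2) = ennreal (var_x f)"
    by (metis ennreal_mult'' zero_le_power2)
  then show ?thesis
    using assms False
    by (simp add: U_def var_x_affine var_omega_affine mult.assoc [symmetric])
qed

section \<open>Integrability of piecewise polynomials\<close>

lemma integrable_poly_indicator:
  fixes q :: "real poly"
  shows "integrable lborel (\<lambda>x. poly q x * indicator {l..<r} x)"
proof -
  have "integrable lborel (\<lambda>x. indicator {l..r} x *\<^sub>R poly q x)"
    by (intro borel_integrable_compact continuous_intros compact_Icc)
  then have "integrable lborel (\<lambda>x. indicator {l..<r} x *\<^sub>R (indicator {l..r} x *\<^sub>R poly q x))"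
    by (rule integrable_mult_indicator [rotated]) simp
  also have "(\<lambda>x. indicator {l..<r} x *\<^sub>R (indicator {l..r} x *\<^sub>R poly q x))
      = (\<lambda>x. poly q x * indicator {l..<r} x)"
    by (auto simp: indicator_def)
  finally show ?thesis .
qed

lemma F_supp_sum:
  assumes "f \<in> F_supp a"
  shows "\<exists>(n::nat) l r P. \<forall>x. x \<noteq> a \<longrightarrow>
    f x = (\<Sum>i=1..n. poly (P i) x * indicator {l i..<r i} x)"
  using assms unfolding F_supp_def by blast

lemma borel_measurable_F_supp:
  assumes "f \<in> F_supp a"
  shows "f \<in> borel_measurable borel"
proof -
  obtain n :: nat and l r P
    where f: "\<And>x. x \<noteq> a \<Longrightarrow> f x = (\<Sum>i=1..n. poly (P i) x * indicator {l i..<r i} x)"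
    using F_supp_sum[OF assms] by blast
  have [measurable]: "poly p \<in> borel_measurable borel" for p :: "real poly"
    by (intro borel_measurable_continuous_onI continuous_intros)
  have "f = (\<lambda>x. if x = a then f a else \<Sum>i=1..n. poly (P i) x * indicator {l i..<r i} x)"
    using f by auto
  also have "\<dots> \<in> borel_measurable borel"
    by measurable
  finally show ?thesis .
qed

text \<open>
  The square of a sum of pieces is the double sum of the products of two pieces, and each product
  is a polynomial on the intersection of two intervals.
\<close>

lemma integrable_poly_F_supp_sq:
  assumes "f \<in> F_supp a"
  shows "integrable lborel (\<lambda>x. poly q x * (f x)\<^sup>2)"
proof -
  obtain n :: nat and l r P
    where f: "\<And>x. x \<noteq> a \<Longrightarrow> f x = (\<Sum>i=1..n. poly (P i) x * indicator {l i..<r i} x)"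
    using F_supp_sum[OF assms] by blast
  let ?T = "\<lambda>i j x. poly (q * P i * P j) x * indicator {max (l i) (l j)..<min (r i) (r j)} x"
  have "integrable lborel (\<lambda>x. \<Sum>i=1..n. \<Sum>j=1..n. ?T i j x)"
    by (intro Bochner_Integration.integrable_sum integrable_poly_indicator)
  \<comment> \<open>The sum of half-open pieces may differ from \<open>f\<close> at \<open>a\<close>, a null set.\<close>
  moreover have "AE x in lborel. (\<Sum>i=1..n. \<Sum>j=1..n. ?T i j x) = poly q x * (f x)\<^sup>2"
    using AE_lborel_singleton[of a]
  proof eventually_elim
    case (elim x)
    show ?case
      unfolding f[OF elim] power2_eq_square sum_product
      unfolding sum_distrib_left
      by (intro sum.cong) (auto simp: indicator_def)
  qed
  moreover have "f \<in> borel_measurable borel"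
    using assms by (rule borel_measurable_F_supp)
  moreover have "poly q \<in> borel_measurable borel"
    by (intro borel_measurable_continuous_onI continuous_intros)
  ultimately show ?thesis
    by (subst integrable_cong_AE[symmetric]) auto
qed

section \<open>Invariance of the uncertainty product and comparison of the infima\<close>

lemma U_F_supp_affine:
  fixes c \<gamma> \<tau> :: real
  assumes "f \<in> F_supp a" "c \<noteq> 0" "\<gamma> \<noteq> 0"
  shows "U (\<lambda>x. complex_of_real (c * f (\<gamma> * x - \<tau>))) = U (\<lambda>x. complex_of_real (f x))"
proof -
  have "(\<lambda>x. complex_of_real (f x)) \<in> borel_measurable borel"
    using borel_measurable_F_supp[OF assms(1)] by measurable
  then show ?thesis
    using U_affine[of "complex_of_real c" \<gamma> "\<lambda>x. complex_of_real (f x)" \<tau>] assms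
      integrable_poly_F_supp_sq[OF assms(1), of 1]
      integrable_poly_F_supp_sq[OF assms(1), of "[:0, 1:]"]
    by simp
qed

theorem lemma3p1:
  fixes a :: real
  assumes "a > 0"
  shows
    "(\<forall>(c::real) (\<gamma>::real) (\<tau>::real). c \<noteq> 0 \<longrightarrow> \<gamma> \<noteq> 0 \<longrightarrow>
        (\<forall>f\<in>F_supp a - {\<lambda>x. 0}.
           U (\<lambda>x. complex_of_real (c * f (\<gamma> * x - \<tau>))) = U (\<lambda>x. complex_of_real (f x))))
     \<and> (INF f\<in>{f \<in> F_supp a - {\<lambda>x. 0}. L2_norm (\<lambda>x. complex_of_real (f x)) \<le> 1}.
            U (\<lambda>x. complex_of_real (f x)))
         \<le> (INF f\<in>{f \<in> F_supp a - {\<lambda>x. 0}. L2_norm (\<lambda>x. complex_of_real (f x)) = 1}.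
              U (\<lambda>x. complex_of_real (f x)))
     \<and> (INF f\<in>{f \<in> F_supp a - {\<lambda>x. 0}. L2_norm (\<lambda>x. complex_of_real (f x)) \<ge> 1}.
            U (\<lambda>x. complex_of_real (f x)))
         \<le> (INF f\<in>{f \<in> F_supp a - {\<lambda>x. 0}. L2_norm (\<lambda>x. complex_of_real (f x)) = 1}.
              U (\<lambda>x. complex_of_real (f x)))
     \<and> (\<forall>c::real. c \<noteq> 0 \<longrightarrow>
          (\<forall>f\<in>F_supp a - {\<lambda>x. 0}.
             U (\<lambda>x. complex_of_real (c * f x)) = U (\<lambda>x. complex_of_real (f x))))"
proof (intro conjI allI impI ballI)
  fix c \<gamma> \<tau> :: real and f
  assume "c \<noteq> 0" "\<gamma> \<noteq> 0" "f \<in> F_supp a - {\<lambda>x. 0}"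
  then show "U (\<lambda>x. complex_of_real (c * f (\<gamma> * x - \<tau>))) = U (\<lambda>x. complex_of_real (f x))"
    by (intro U_F_supp_affine) auto
next
  fix c :: real and f
  assume "c \<noteq> 0" "f \<in> F_supp a - {\<lambda>x. 0}"
  then show "U (\<lambda>x. complex_of_real (c * f x)) = U (\<lambda>x. complex_of_real (f x))"
    using U_F_supp_affine[of f a c 1 0] by simp
qed (intro INF_superset_mono; auto)+

end
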